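(* Let $\sigma:\mathbb{R}\to\mathbb{R}$ be a continuously differentiable convergent strategy. (i) If $\sigma$ is an equilibrium strategy, then the value function $$v(k):=\int_0^\infty h(t)\,u\big(\sigma(\mathcal{K}(\sigma;t,k))\big)\,dt$$ satisfies, for all $k$, the functional equation $$v(k)=\int_0^\infty h(t)\,u\Big(i\circ v'\big(\mathcal{K}(i\circ v';t,k)\big)\Big)\,dt \qquad (\mathrm{IE})$$ and the instantaneous optimality condition $$u'(\sigma(k))=v'(k),\qquad \sigma(k)=i(v'(k)).$$ (ii) Conversely, if a function $v$ is twice continuously differentiable, satisfies (IE) for all $k$, and the strategy $\sigma=i\circ v'$ is convergent, then $\sigma$ is an equilibrium strategy.
   Context: Data. The utility function $u$ is defined on an open interval $C\subseteq\mathbb{R}$ of admissible consumption levels and is strictly increasing, twice continuously differentiable and strictly concave; $i$ denotes the inverse function of $u'$, and $i\circ v'(x)=i(v'(x))$ (whenever $i\circ v'$ is written, $v'$ is understood to take values in the range of $u'$). The discount function $h:[0,\infty)\to[0,\infty)$ is continuously differentiable with $h(0)=1$ and $\int_0^\infty h(s)\,ds<\infty$. The production function $f:\mathbb{R}\to\mathbb{R}$ is strictly increasing, concave and continuously differentiable. Strategies and flow. A (Markov) strategy is a continuously differentiable function $\sigma:\mathbb{R}\to\mathbb{R}$ with values in $C$. Its flow $\mathcal{K}(\sigma;t,k)$, $t\ge 0$, is defined by $$\frac{\partial \mathcal{K}(\sigma;t,k)}{\partial t}=f(\mathcal{K}(\sigma;t,k))-\sigma(\mathcal{K}(\sigma;t,k)),\qquad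 \mathcal{K}(\sigma;0,k)=k.$$ The strategy $\sigma$ converges to $\bar k$ if $\mathcal{K}(\sigma;t,k_0)\to\bar k$ as $t\to\infty$ whenever $k_0$ is sufficiently close to $\bar k$; $\sigma$ is convergent if it converges to some $\bar k$. Standing convention: for the convergent strategies considered, the flow exists for all $t\ge 0$, the integrals $\int_0^\infty h(t)u(\sigma(\mathcal{K}(\sigma;t,k)))\,dt$ converge, and their successive derivatives in $k$ can be computed by differentiating under the integral sign. Equilibrium. For $k\in\mathbb{R}$, a strategy $\sigma$ and $c\in C$, put $$P_1(k,\sigma,c)=u(c)-u(\sigma(k))+\int_0^\infty h(t)\,u'(\sigma(k_0(t)))\,\sigma'(k_0(t))\,k_1(t)\,dt,$$ where $k_0(t)=\mathcal{K}(\sigma;t,k)$ and $k_1$ solves the linear equation $$\frac{dk_1}{dt}=\big(f'(k_0(t))-\sigma'(k_0(t))\big)k_1(t),\ t\ge 0,\qquad k_1(0)=\sigma(k)-c.$$ A convergent strategy $\sigma$ is an equilibrium strategy if, for every $k\in\mathbb{R}$, $\sigma(k)=\arg\max_{c}P_1(k,\sigma,c)$. *)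

theory Defs
  imports "HOL-Analysis.Analysis"
begin

definition strictly_concave_on :: "real set \<Rightarrow> (real \<Rightarrow> real) \<Rightarrow> bool" where
  "strictly_concave_on S g \<longleftrightarrow>
     convex S \<and>
     (\<forall>x\<in>S. \<forall>y\<in>S. \<forall>s. x \<noteq> y \<longrightarrow> 0 < s \<longrightarrow> s < 1 \<longrightarrow>
        (1 - s) * g x + s * g y < g ((1 - s) * x + s * y))"

text \<open>
  The discount function \<open>h\<close> lives on \<open>[0, \<infinity>)\<close>; its derivative at \<open>0\<close> is one-sided, and its values
  at negative arguments are never used.
\<close>

locale growth_model =
  fixes C :: "real set" and u h f :: "real \<Rightarrow> real"
  assumes C_open: "open C" and C_interval: "is_interval C" and C_nonempty: "C \<noteq> {}"
    and u_strict_mono: "strict_mono_on C u"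
    and u_C1: "u C1_differentiable_on C"
    and u_C2: "deriv u C1_differentiable_on C"
    and u_strictly_concave: "strictly_concave_on C u"
    and h_nonneg: "\<And>t. 0 \<le> t \<Longrightarrow> 0 \<le> h t"
    and h_C1: "\<exists>h'. (\<forall>t\<ge>0. (h has_real_derivative h' t) (at t within {0..})) \<and>
                    continuous_on {0..} h'"
    and h_0: "h 0 = 1"
    and h_integrable: "h integrable_on {0..}"
    and f_strict_mono: "strict_mono f"
    and f_concave: "concave_on UNIV f"
    and f_C1: "f C1_differentiable_on UNIV"

text \<open>The inverse \<open>i\<close> of the marginal utility; only its values on \<open>deriv u ` C\<close> are meaningful.\<close>

definition inv_marginal :: "real set \<Rightarrow> (real \<Rightarrow> real) \<Rightarrow> real \<Rightarrow> real" where
  "inv_marginal C u = inv_into C (deriv u)"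

definition strategy :: "real set \<Rightarrow> (real \<Rightarrow> real) \<Rightarrow> bool" where
  "strategy C \<sigma> \<longleftrightarrow> \<sigma> C1_differentiable_on UNIV \<and> range \<sigma> \<subseteq> C"

definition flow_solution ::
  "(real \<Rightarrow> real) \<Rightarrow> (real \<Rightarrow> real) \<Rightarrow> real \<Rightarrow> (real \<Rightarrow> real) \<Rightarrow> bool" where
  "flow_solution f \<sigma> k x \<longleftrightarrow>
     x 0 = k \<and>
     (\<forall>t\<ge>0. (x has_real_derivative f (x t) - \<sigma> (x t)) (at t within {0..}))"

text \<open>
  Because \<open>f\<close> and \<open>\<sigma>\<close> are continuously differentiable, a solution on \<open>[0, \<infinity>)\<close> is unique there if it
  exists, so the choice below is immaterial for \<open>t \<ge> 0\<close>. Existence is part of \<open>regular_strategy\<close>.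
\<close>

definition flow :: "(real \<Rightarrow> real) \<Rightarrow> (real \<Rightarrow> real) \<Rightarrow> real \<Rightarrow> real \<Rightarrow> real" where
  "flow f \<sigma> t k = (SOME x. flow_solution f \<sigma> k x) t"

definition converges_to :: "(real \<Rightarrow> real) \<Rightarrow> (real \<Rightarrow> real) \<Rightarrow> real \<Rightarrow> bool" where
  "converges_to f \<sigma> kbar \<longleftrightarrow>
     (\<forall>\<^sub>F k0 in nhds kbar. ((\<lambda>t. flow f \<sigma> t k0) \<longlongrightarrow> kbar) at_top)"

definition convergent_strategy :: "real set \<Rightarrow> (real \<Rightarrow> real) \<Rightarrow> (real \<Rightarrow> real) \<Rightarrow> bool" where
  "convergent_strategy C f \<sigma> \<longleftrightarrow> strategy C \<sigma> \<and> (\<exists>kbar. converges_to f \<sigma> kbar)"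

text \<open>
  Integrals over \<open>[0, \<infinity>)\<close> are Henstock--Kurzweil integrals, which include absolutely as well as
  conditionally convergent improper integrals.
\<close>

definition value_function ::
  "(real \<Rightarrow> real) \<Rightarrow> (real \<Rightarrow> real) \<Rightarrow> (real \<Rightarrow> real) \<Rightarrow> (real \<Rightarrow> real) \<Rightarrow> real \<Rightarrow> real" where
  "value_function u h f \<sigma> k = integral {0..} (\<lambda>t. h t * u (\<sigma> (flow f \<sigma> t k)))"

text \<open>
  The standing convention on strategies: the flow is global in forward time, the payoff integrals
  converge, and their successive derivatives in \<open>k\<close> are obtained by differentiating under the
  integral sign. The last clause concerns every order \<open>Suc n\<close> up to which the integrand is
  differentiable in \<open>k\<close>, and includes convergence of the differentiated integral.
\<close>

definition regular_strategy ::
  "(real \<Rightarrow> real) \<Rightarrow> (real \<Rightarrow> real) \<Rightarrow> (real \<Rightarrow> real) \<Rightarrow> (real \<Rightarrow> real) \<Rightarrow> bool" where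
  "regular_strategy u h f \<sigma> \<longleftrightarrow>
     (\<forall>k. \<exists>x. flow_solution f \<sigma> k x) \<and>
     (\<forall>k. (\<lambda>t. h t * u (\<sigma> (flow f \<sigma> t k))) integrable_on {0..}) \<and>
     (\<forall>n. (\<forall>m\<le>n. \<forall>t\<ge>0. \<forall>k.
              (deriv ^^ m) (\<lambda>\<kappa>. u (\<sigma> (flow f \<sigma> t \<kappa>))) differentiable at k) \<longrightarrow>
          (\<forall>k. (\<lambda>t. h t * (deriv ^^ Suc n) (\<lambda>\<kappa>. u (\<sigma> (flow f \<sigma> t \<kappa>))) k) integrable_on {0..} \<and>
               ((deriv ^^ n) (value_function u h f \<sigma>) has_real_derivative
                  integral {0..} (\<lambda>t. h t * (deriv ^^ Suc n) (\<lambda>\<kappa>. u (\<sigma> (flow f \<sigma> t \<kappa>))) k))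
                 (at k)))"

definition linearized_solution ::
  "(real \<Rightarrow> real) \<Rightarrow> (real \<Rightarrow> real) \<Rightarrow> real \<Rightarrow> real \<Rightarrow> (real \<Rightarrow> real) \<Rightarrow> bool" where
  "linearized_solution f \<sigma> k a y \<longleftrightarrow>
     y 0 = a \<and>
     (\<forall>t\<ge>0. (y has_real_derivative
               (deriv f (flow f \<sigma> t k) - deriv \<sigma> (flow f \<sigma> t k)) * y t) (at t within {0..}))"

text \<open>
  The linear equation has continuous coefficients along a global trajectory, so its solution exists
  and is unique on \<open>[0, \<infinity>)\<close>.
\<close>

definition linearized_flow ::
  "(real \<Rightarrow> real) \<Rightarrow> (real \<Rightarrow> real) \<Rightarrow> real \<Rightarrow> real \<Rightarrow> real \<Rightarrow> real" where
  "linearized_flow f \<sigma> k a t = (SOME y. linearized_solution f \<sigma> k a y) t"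

definition P1 ::
  "(real \<Rightarrow> real) \<Rightarrow> (real \<Rightarrow> real) \<Rightarrow> (real \<Rightarrow> real) \<Rightarrow> real \<Rightarrow> (real \<Rightarrow> real) \<Rightarrow> real \<Rightarrow> real" where
  "P1 u h f k \<sigma> c =
     u c - u (\<sigma> k) +
     integral {0..} (\<lambda>t. h t * deriv u (\<sigma> (flow f \<sigma> t k)) * deriv \<sigma> (flow f \<sigma> t k) *
                         linearized_flow f \<sigma> k (\<sigma> k - c) t)"

definition equilibrium_strategy ::
  "real set \<Rightarrow> (real \<Rightarrow> real) \<Rightarrow> (real \<Rightarrow> real) \<Rightarrow> (real \<Rightarrow> real) \<Rightarrow> (real \<Rightarrow> real) \<Rightarrow> bool" where
  "equilibrium_strategy C u h f \<sigma> \<longleftrightarrow>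
     convergent_strategy C f \<sigma> \<and>
     (\<forall>k. {c. is_arg_max (P1 u h f k \<sigma>) (\<lambda>c. c \<in> C) c} = {\<sigma> k})"

definition integrated_equation ::
  "real set \<Rightarrow> (real \<Rightarrow> real) \<Rightarrow> (real \<Rightarrow> real) \<Rightarrow> (real \<Rightarrow> real) \<Rightarrow> (real \<Rightarrow> real) \<Rightarrow> bool" where
  "integrated_equation C u h f v \<longleftrightarrow>
     (\<forall>k. ((\<lambda>t. h t * u ((inv_marginal C u \<circ> deriv v) (flow f (inv_marginal C u \<circ> deriv v) t k)))
            has_integral v k) {0..})"

end

theory Submission
  imports Defs
begin

text \<open>
  The difference \<open>d\<close> of two trajectories of \<open>x' = g x\<close> solves the linear equation \<open>d' = G d\<close>, where
  \<open>G\<close> is the divided difference of \<open>g\<close> along the two trajectories. Hence \<open>d t = d 0 * exp (\<integral> G)\<close>,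
  which gives uniqueness, monotonicity in the initial value and, in the limit, differentiability of
  the flow in the initial value, its derivative being the linearized flow started at \<open>1\<close>.
  Consequently \<open>P1 k \<sigma> c = u c - u (\<sigma> k) + (\<sigma> k - c) * v' k\<close>, a strictly concave function of \<open>c\<close>,
  whose maximum is at \<open>\<sigma> k\<close> if and only if \<open>u' (\<sigma> k) = v' k\<close>.
\<close>

section \<open>Scalar linear equations\<close>

lemma integral_from_0_has_real_derivative:
  fixes a :: "real \<Rightarrow> real"
  assumes "continuous_on {0..} a" "t \<ge> 0"
  shows "((\<lambda>t. integral {0..t} a) has_real_derivative a t) (at t within {0..})"
proof -
  \<comment> \<open>The right end \<open>t + 1\<close> lies strictly beyond \<open>t\<close>, so
    near \<open>t\<close> the compact interval and the half-line coincide, also at the endpoint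
    \<open>t = 0\<close>.\<close>
  have "((\<lambda>t. integral {0..t} a) has_real_derivative a t) (at t within {0..t+1})"
    using assms by (intro integral_has_real_derivative continuous_on_subset[OF assms(1)]) auto
  moreover have "at t within {0..t+1} = at t within {0..}"
    by (rule at_within_nhd[where S="{..<t+1}"]) auto
  ultimately show ?thesis by simp
qed

lemma linear_ode_exp_solution:
  fixes a :: "real \<Rightarrow> real"
  assumes "continuous_on {0..} a" "t \<ge> 0"
  shows "((\<lambda>t. c * exp (integral {0..t} a)) has_real_derivative a t * (c * exp (integral {0..t} a)))
    (at t within {0..})"
  by (rule derivative_eq_intros integral_from_0_has_real_derivative[OF assms] refl)+ simp

text \<open>The integrating factor \<open>exp (- integral {0..t} a)\<close> turns \<open>y\<close>
  into a function with zero derivative on the half-line, hence a constant.\<close>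

lemma linear_ode_unique:
  fixes a y :: "real \<Rightarrow> real"
  assumes a: "continuous_on {0..} a"
    and y: "\<And>t. t \<ge> 0 \<Longrightarrow> (y has_real_derivative a t * y t) (at t within {0..})"
    and t: "t \<ge> 0"
  shows "y t = y 0 * exp (integral {0..t} a)"
proof -
  let ?w = "\<lambda>t. y t * exp (- integral {0..t} a)"
  have "(?w has_real_derivative 0) (at t within {0..})" if "t \<in> {0..}" for t
    using that
    by (auto intro!: derivative_eq_intros y integral_from_0_has_real_derivative[OF a])
  then obtain c where c: "\<forall>t\<in>{0..}. ?w t = c"
    using has_field_derivative_zero_constant[of "{0..}" ?w] by (auto simp: convex_real_interval)
  have "?w t = ?w 0" using bspec[OF c, of t] bspec[OF c, of 0] t by simp
  then show ?thesis by (simp add: exp_minus field_simps)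
qed

section \<open>Dependence of a scalar flow on the initial value\<close>

text \<open>For C1 functions this is the difference quotient of \<open>g\<close>. Averaging the
  derivative over the segment, instead of dividing, extends it continuously to the diagonal.\<close>

definition divided_difference :: "(real \<Rightarrow> real) \<Rightarrow> real \<Rightarrow> real \<Rightarrow> real" where
  "divided_difference g a b = integral {0..1} (\<lambda>s. deriv g (b + s * (a - b)))"

lemma divided_difference_same [simp]: "divided_difference g a a = deriv g a"
  by (simp add: divided_difference_def)

lemma C1_differentiable_on_UNIV_iff:
  fixes g :: "real \<Rightarrow> real"
  shows "g C1_differentiable_on UNIV \<longleftrightarrow>
    (\<forall>x. (g has_real_derivative deriv g x) (at x)) \<and> continuous_on UNIV (deriv g)"
proof
  assume "g C1_differentiable_on UNIV"
  then obtain D where D: "\<And>x. (g has_real_derivative D x) (at x)" "continuous_on UNIV D"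
    by (auto simp: C1_differentiable_on_def has_real_derivative_iff_has_vector_derivative)
  then have "deriv g = D" by (auto intro: DERIV_imp_deriv)
  with D show "(\<forall>x. (g has_real_derivative deriv g x) (at x)) \<and> continuous_on UNIV (deriv g)"
    by simp
qed (auto simp: C1_differentiable_on_def has_real_derivative_iff_has_vector_derivative)

text \<open>The fundamental theorem of calculus along the segment from \<open>b\<close> to
  \<open>a\<close>. The product form also covers \<open>a = b\<close>.\<close>

lemma divided_difference_mult:
  assumes "g C1_differentiable_on UNIV"
  shows "divided_difference g a b * (a - b) = g a - g b"
proof -
  note g = assms[unfolded C1_differentiable_on_UNIV_iff]
  have "((\<lambda>s. g (b + s * (a - b))) has_real_derivative deriv g (b + s * (a - b)) * (a - b))
      (at s within {0..1})" for s
    by (rule DERIV_chain'[where g=g]) (auto intro!: derivative_eq_intros spec[OF conjunct1[OF g]])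
  then have "((\<lambda>s. deriv g (b + s * (a - b)) * (a - b)) has_integral
      g (b + 1 * (a - b)) - g (b + 0 * (a - b))) {0..1}"
    by (intro fundamental_theorem_of_calculus)
      (auto simp: has_real_derivative_iff_has_vector_derivative)
  from integral_unique[OF this] show ?thesis
    by (simp add: divided_difference_def)
qed

text \<open>Joint continuity serves twice: it makes the coefficient of the linear equation
  continuous in time, and it gives bounds and uniform continuity on compact sets of pairs.\<close>

lemma continuous_on_divided_difference:
  assumes "g C1_differentiable_on UNIV"
  shows "continuous_on UNIV (\<lambda>p. divided_difference g (fst p) (snd p))"
proof -
  have "continuous_on UNIV (deriv g)"
    using assms by (simp add: C1_differentiable_on_UNIV_iff)
  then have "continuous_on (UNIV \<times> cbox 0 1)
      (\<lambda>(p, s). deriv g (snd p + s * (fst p - snd p)))"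
    unfolding case_prod_beta
    by (rule continuous_on_compose2) (auto intro!: continuous_intros)
  from integral_continuous_on_param[OF this] show ?thesis
    by (simp add: divided_difference_def)
qed

lemma continuous_on_divided_difference_compose [continuous_intros]:
  assumes "g C1_differentiable_on UNIV" "continuous_on S x" "continuous_on S y"
  shows "continuous_on S (\<lambda>t. divided_difference g (x t) (y t))"
  using continuous_on_compose2[OF continuous_on_divided_difference[OF assms(1)],
      of S "\<lambda>t. (x t, y t)"] assms(2,3)
  by (auto intro: continuous_intros)

text \<open>An exact formula in place of a Gronwall estimate: it also shows that the difference
  never changes sign.\<close>

lemma trajectory_difference:
  fixes g x y :: "real \<Rightarrow> real"
  assumes g: "g C1_differentiable_on UNIV"
    and x: "\<And>t. t \<ge> 0 \<Longrightarrow> (x has_real_derivative g (x t)) (at t within {0..})"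
    and y: "\<And>t. t \<ge> 0 \<Longrightarrow> (y has_real_derivative g (y t)) (at t within {0..})"
    and t: "t \<ge> 0"
  shows "x t - y t =
    (x 0 - y 0) * exp (integral {0..t} (\<lambda>s. divided_difference g (x s) (y s)))"
proof (rule linear_ode_unique[where y="\<lambda>t. x t - y t"])
  have "continuous_on {0..} x" "continuous_on {0..} y"
    using x y by (auto intro!: DERIV_continuous_on)
  then show "continuous_on {0..} (\<lambda>s. divided_difference g (x s) (y s))"
    by (intro continuous_intros g)
  show "((\<lambda>t. x t - y t) has_real_derivative divided_difference g (x t) (y t) * (x t - y t))
      (at t within {0..})" if "t \<ge> 0" for t
    using DERIV_diff[OF x[OF that] y[OF that]] by (simp add: divided_difference_mult[OF g])
qed (rule t)

text \<open>By the exact formula, the difference quotient in the initial value is the exponential of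
  \<open>integral {0..T} (?G a)\<close>. It remains to pass to the limit \<open>a\<close> to
  \<open>k\<close> under this integral, which uniform convergence of the trajectories on
  \<open>{0..T}\<close> permits.\<close>

lemma flow_has_real_derivative_initial:
  fixes g :: "real \<Rightarrow> real" and x :: "real \<Rightarrow> real \<Rightarrow> real"
  assumes g: "g C1_differentiable_on UNIV"
    and x0: "\<And>k. x k 0 = k"
    and x: "\<And>k t. t \<ge> 0 \<Longrightarrow> (x k has_real_derivative g (x k t)) (at t within {0..})"
    and T: "T \<ge> 0"
  shows "((\<lambda>k. x k T) has_real_derivative exp (integral {0..T} (\<lambda>s. deriv g (x k s)))) (at k)"
proof -
  let ?G = "\<lambda>k' s. divided_difference g (x k' s) (x k s)"
  have diff: "x a t - x b t =
      (a - b) * exp (integral {0..t} (\<lambda>s. divided_difference g (x a s) (x b s)))"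
    if "t \<ge> 0" for a b t
    using trajectory_difference[OF g x x that, of a b] by (simp add: x0)
  have mono: "x a t \<le> x b t" if "a \<le> b" "t \<ge> 0" for a b t
    using diff[OF that(2), of a b] that(1)
    by (metis diff_le_0_iff_le exp_ge_zero mult_nonpos_nonneg)
  have cont: "continuous_on {0..T} (x a)" for a
    by (rule continuous_on_subset[of "{0..}"]) (auto intro!: DERIV_continuous_on x)
  have Gcont: "continuous_on {0..T} (?G a)" for a
    by (intro continuous_intros g cont)
  \<comment> \<open>By monotonicity the outer two trajectories confine all those in between to a compact set.\<close>
  obtain M1 where M1: "\<And>t. t \<in> {0..T} \<Longrightarrow> \<bar>x (k - 1) t\<bar> \<le> M1"
    using continuous_on_compact_bound[OF compact_Icc cont[of "k - 1"]] by auto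
  obtain M2 where M2: "\<And>t. t \<in> {0..T} \<Longrightarrow> \<bar>x (k + 1) t\<bar> \<le> M2"
    using continuous_on_compact_bound[OF compact_Icc cont[of "k + 1"]] by auto
  define K where "K = {-M1..M2} \<times> {-M1..M2}"
  have "compact K" by (simp add: K_def compact_Times)
  have xI: "x a t \<in> {-M1..M2}" if "\<bar>a - k\<bar> \<le> 1" "t \<in> {0..T}" for a t
  proof -
    have "x (k - 1) t \<le> x a t" "x a t \<le> x (k + 1) t"
      using that by (auto intro!: mono)
    then show ?thesis
      using M1[OF that(2)] M2[OF that(2)] by (simp add: abs_le_iff)
  qed
  have Kcont: "continuous_on K (\<lambda>p. divided_difference g (fst p) (snd p))"
    using continuous_on_divided_difference[OF g] continuous_on_subset by blast
  obtain B where B0: "B \<ge> 0"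
    and B: "\<And>p. p \<in> K \<Longrightarrow> norm (divided_difference g (fst p) (snd p)) \<le> B"
    using continuous_on_compact_bound[OF \<open>compact K\<close> Kcont] by blast
  \<comment> \<open>A Lipschitz bound uniform in time: on \<open>K\<close> the exponent in the exact
    formula is at most \<open>B * T\<close>.\<close>
  have close: "\<bar>x a t - x k t\<bar> \<le> \<bar>a - k\<bar> * exp (B * T)"
    if a: "\<bar>a - k\<bar> \<le> 1" and t: "t \<in> {0..T}" for a t
  proof -
    have "norm (integral {0..t} (?G a)) \<le> B * (t - 0)"
    proof (rule integral_bound)
      show "continuous_on {0..t} (?G a)"
        using t by (auto intro: continuous_on_subset[OF Gcont])
      show "norm (?G a s) \<le> B" if "s \<in> {0..t}" for s
        using B[of "(x a s, x k s)"] xI[of a s] xI[of k s] a that t by (auto simp: K_def)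
    qed (use t in auto)
    also have "\<dots> \<le> B * T" using t B0 by (auto intro: mult_left_mono)
    finally have "exp (integral {0..t} (?G a)) \<le> exp (B * T)" by simp
    then show ?thesis
      using diff[of t a k] t by (auto simp: abs_mult intro: mult_left_mono)
  qed
  have "(\<lambda>a. integral {0..T} (?G a)) \<midarrow>k\<rightarrow> integral {0..T} (?G k)"
  proof (rule LIM_I)
    fix e :: real assume "e > 0"
    \<comment> \<open>Dividing by \<open>T + 1\<close> rather than \<open>T\<close> keeps
      \<open>e' * T < e\<close> strict and allows \<open>T = 0\<close>.\<close>
    define e' where "e' = e / (T + 1)"
    have "e' > 0" using \<open>e > 0\<close> T by (simp add: e'_def)
    then obtain d where d: "d > 0" and dd: "\<And>p q. p \<in> K \<Longrightarrow> q \<in> K \<Longrightarrow> dist q p < d \<Longrightarrow>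
        dist (divided_difference g (fst q) (snd q)) (divided_difference g (fst p) (snd p)) < e'"
      using compact_uniformly_continuous[OF Kcont \<open>compact K\<close>]
      unfolding uniformly_continuous_on_def by metis
    \<comment> \<open>The bound 1 keeps the trajectories inside \<open>K\<close>; the other bound
      makes \<open>close\<close> yield a distance below \<open>d\<close>.\<close>
    define r where "r = min 1 (d * exp (- (B * T)))"
    have "norm (integral {0..T} (?G a) - integral {0..T} (?G k)) < e"
      if "a \<noteq> k \<and> norm (a - k) < r" for a
    proof -
      have a: "\<bar>a - k\<bar> \<le> 1" "\<bar>a - k\<bar> * exp (B * T) < d"
        using that by (auto simp: r_def exp_minus field_simps)
      have "integral {0..T} (?G a) - integral {0..T} (?G k) = integral {0..T} (\<lambda>s. ?G a s - ?G k s)"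
        by (rule integral_diff[symmetric]) (intro integrable_continuous_real Gcont)+
      also have "norm \<dots> \<le> e' * (T - 0)"
      proof (rule integral_bound[OF T])
        show "continuous_on {0..T} (\<lambda>s. ?G a s - ?G k s)"
          by (intro continuous_on_diff Gcont)
        \<comment> \<open>The second pair lies on the diagonal and shares its second coordinate with
          the first, so their distance is just that of the two trajectories at time
          \<open>s\<close>.\<close>
        show "norm (?G a s - ?G k s) \<le> e'" if "s \<in> {0..T}" for s
          using dd[of "(x k s, x k s)" "(x a s, x k s)"] close[OF a(1) that] a xI[OF _ that]
          by (auto simp: K_def dist_Pair_Pair dist_real_def)
      qed
      also have "\<dots> < e" using \<open>e > 0\<close> T by (simp add: e'_def field_simps)
      finally show ?thesis .
    qed
    moreover have "r > 0" using d by (simp add: r_def)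
    ultimately show "\<exists>r>0. \<forall>a. a \<noteq> k \<and> norm (a - k) < r \<longrightarrow>
        norm (integral {0..T} (?G a) - integral {0..T} (?G k)) < e" by blast
  qed
  then have "(\<lambda>a. exp (integral {0..T} (?G a))) \<midarrow>k\<rightarrow> exp (integral {0..T} (\<lambda>s. deriv g (x k s)))"
    by (intro tendsto_exp) simp
  moreover have "\<forall>\<^sub>F a in at k. exp (integral {0..T} (?G a)) = (x a T - x k T) / (a - k)"
    using diff[OF T, of _ k] by (auto simp: eventually_at_filter)
  ultimately show ?thesis
    unfolding has_field_derivative_iff by (rule Lim_transform_eventually)
qed

section \<open>Marginal utility\<close>

context growth_model
begin

lemma u_has_real_derivative: "x \<in> C \<Longrightarrow> (u has_real_derivative deriv u x) (at x)"
  using u_C1 unfolding C1_differentiable_on_def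
  by (metis DERIV_imp_deriv has_real_derivative_iff_has_vector_derivative)

text \<open>Strictness comes from the midpoint: there \<open>u\<close> is at most the tangent value
  by ordinary concavity, yet strictly above the average of \<open>u x\<close> and
  \<open>u y\<close>.\<close>

lemma u_below_tangent:
  assumes x: "x \<in> C" and y: "y \<in> C" and "x \<noteq> y"
  shows "u y < u x + deriv u x * (y - x)"
proof -
  let ?m = "(x + y) / 2"
  note sc = u_strictly_concave[unfolded strictly_concave_on_def]
  have conv: "convex_on C (\<lambda>z. - u z)"
  proof (rule convex_onI)
    show "- u ((1 - t) *\<^sub>R a + t *\<^sub>R b) \<le> (1 - t) * - u a + t * - u b"
      if "0 < t" "t < 1" "a \<in> C" "b \<in> C" for t a b
    proof (cases "a = b")
      case True
      then show ?thesis by (simp add: algebra_simps)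
    next
      case False
      have "(1 - t) * u a + t * u b < u ((1 - t) * a + t * b)"
        using sc that False by blast
      then show ?thesis by simp
    qed
  qed (use sc in blast)
  have avg: "(1 - 1/2) * u x + (1/2) * u y < u ((1 - 1/2) * x + (1/2) * y)"
    by (rule sc[THEN conjunct2, rule_format]) (use x y \<open>x \<noteq> y\<close> in auto)
  have eq: "(1 - 1/2) * x + (1/2) * y = ?m" by simp
  have "?m \<in> C"
    using sc x y convexD[of C x y "1/2" "1/2"] by (simp add: add_divide_distrib)
  moreover have "((\<lambda>z. - u z) has_real_derivative - deriv u x) (at x within C)"
    by (rule has_field_derivative_at_within[OF DERIV_minus[OF u_has_real_derivative[OF x]]])
  ultimately have "- u ?m - - u x \<ge> - deriv u x * (?m - x)"
    using C_open C_interval x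
    by (intro convex_on_imp_above_tangent[OF conv])
      (simp_all add: interior_open is_interval_connected)
  moreover have "deriv u x * (?m - x) = deriv u x * (y - x) / 2"
    by (simp add: field_simps)
  ultimately show ?thesis
    using avg unfolding eq by simp
qed

text \<open>With equal slopes at two distinct points, adding the strict tangent inequalities taken
  from each point gives \<open>0 < 0\<close>. Hence \<open>inv_marginal C u\<close> undoes
  \<open>deriv u\<close> on \<open>C\<close>.\<close>

lemma inj_on_deriv_u: "inj_on (deriv u) C"
proof (rule inj_onI, rule ccontr)
  fix x y assume *: "x \<in> C" "y \<in> C" "deriv u x = deriv u y" "x \<noteq> y"
  show False
    using u_below_tangent[of x y] u_below_tangent[of y x] * by (auto simp: algebra_simps)
qed

section \<open>The payoff of a deviation\<close>

context
  fixes \<sigma> :: "real \<Rightarrow> real"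
  assumes strat: "strategy C \<sigma>" and reg: "regular_strategy u h f \<sigma>"
begin

lemma sigma_in_C: "\<sigma> k \<in> C"
  using strat by (auto simp: strategy_def)

lemma f_sigma_has_real_derivative:
  "(f has_real_derivative deriv f x) (at x)" "(\<sigma> has_real_derivative deriv \<sigma> x) (at x)"
  using f_C1 strat by (auto simp: strategy_def C1_differentiable_on_UNIV_iff)

lemma drift_C1: "(\<lambda>x. f x - \<sigma> x) C1_differentiable_on UNIV"
  using f_C1 strat by (auto simp: strategy_def intro: C1_differentiable_on_diff)

lemma deriv_drift: "deriv (\<lambda>x. f x - \<sigma> x) = (\<lambda>x. deriv f x - deriv \<sigma> x)"
  by (intro ext DERIV_imp_deriv DERIV_diff f_sigma_has_real_derivative)

lemma flow_solution_flow: "flow_solution f \<sigma> k (\<lambda>t. flow f \<sigma> t k)"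
proof -
  have "\<exists>x. flow_solution f \<sigma> k x"
    using reg by (simp add: regular_strategy_def)
  from someI_ex[OF this] show ?thesis by (simp add: flow_def)
qed

lemma flow_0: "flow f \<sigma> 0 k = k"
  using flow_solution_flow[of k] by (simp add: flow_solution_def)

lemma flow_has_real_derivative_time:
  "t \<ge> 0 \<Longrightarrow> ((\<lambda>t. flow f \<sigma> t k) has_real_derivative f (flow f \<sigma> t k) - \<sigma> (flow f \<sigma> t k))
     (at t within {0..})"
  using flow_solution_flow[of k] by (simp add: flow_solution_def)

text \<open>The explicit exponential witnesses existence and uniqueness identifies the chosen
  solution with it. The formula makes the dependence on the initial value \<open>a\<close> visibly
  linear.\<close>

lemma linearized_flow_eq:
  assumes t: "t \<ge> 0"
  shows "linearized_flow f \<sigma> k a t =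
    a * exp (integral {0..t} (\<lambda>s. deriv f (flow f \<sigma> s k) - deriv \<sigma> (flow f \<sigma> s k)))"
    (is "_ = a * exp (integral _ ?A)")
proof -
  have "continuous_on UNIV (\<lambda>x. deriv f x - deriv \<sigma> x)"
    using drift_C1 by (simp add: C1_differentiable_on_UNIV_iff deriv_drift)
  moreover have "continuous_on {0..} (\<lambda>t. flow f \<sigma> t k)"
    by (auto intro!: DERIV_continuous_on flow_has_real_derivative_time)
  ultimately have A: "continuous_on {0..} ?A"
    by (rule continuous_on_compose2) auto
  have "linearized_solution f \<sigma> k a (\<lambda>t. a * exp (integral {0..t} ?A))"
    using linear_ode_exp_solution[OF A] by (simp add: linearized_solution_def)
  moreover have "linearized_flow f \<sigma> k a = (SOME y. linearized_solution f \<sigma> k a y)"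
    by (simp add: fun_eq_iff linearized_flow_def)
  ultimately have sol: "linearized_solution f \<sigma> k a (linearized_flow f \<sigma> k a)"
    by (metis someI)
  then have "linearized_flow f \<sigma> k a t = linearized_flow f \<sigma> k a 0 * exp (integral {0..t} ?A)"
    by (intro linear_ode_unique[OF A _ t]) (simp add: linearized_solution_def)
  with sol show ?thesis by (simp add: linearized_solution_def)
qed

lemma flow_has_real_derivative_initial_value:
  assumes t: "t \<ge> 0"
  shows "((\<lambda>k. flow f \<sigma> t k) has_real_derivative linearized_flow f \<sigma> k 1 t) (at k)"
  using flow_has_real_derivative_initial[OF drift_C1, of "\<lambda>k t. flow f \<sigma> t k" t k]
    flow_0 flow_has_real_derivative_time t
  by (simp add: deriv_drift linearized_flow_eq)

lemma utility_flow_has_real_derivative: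
  assumes t: "t \<ge> 0"
  shows "((\<lambda>\<kappa>. u (\<sigma> (flow f \<sigma> t \<kappa>))) has_real_derivative
    deriv u (\<sigma> (flow f \<sigma> t k)) * deriv \<sigma> (flow f \<sigma> t k) * linearized_flow f \<sigma> k 1 t) (at k)"
  using DERIV_chain2[OF u_has_real_derivative[OF sigma_in_C]
      DERIV_chain2[OF f_sigma_has_real_derivative(2) flow_has_real_derivative_initial_value[OF t]]]
  by (simp add: mult.assoc)

text \<open>The case \<open>n = 0\<close> of the differentiation clause in
  \<open>regular_strategy\<close>; its premise is the differentiability in the initial value just
  obtained from the chain rule.\<close>

lemma value_function_has_real_derivative:
  "(value_function u h f \<sigma> has_real_derivative
     integral {0..} (\<lambda>t. h t * (deriv u (\<sigma> (flow f \<sigma> t k)) * deriv \<sigma> (flow f \<sigma> t k) *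
       linearized_flow f \<sigma> k 1 t))) (at k)"
proof -
  have "\<forall>m\<le>0. \<forall>t\<ge>0. \<forall>k. (deriv ^^ m) (\<lambda>\<kappa>. u (\<sigma> (flow f \<sigma> t \<kappa>))) differentiable at k"
    using utility_flow_has_real_derivative by (auto simp: real_differentiable_def)
  then have "((deriv ^^ 0) (value_function u h f \<sigma>) has_real_derivative
      integral {0..} (\<lambda>t. h t * (deriv ^^ Suc 0) (\<lambda>\<kappa>. u (\<sigma> (flow f \<sigma> t \<kappa>))) k)) (at k)"
    using reg unfolding regular_strategy_def by blast
  moreover have "integral {0..} (\<lambda>t. h t * deriv (\<lambda>\<kappa>. u (\<sigma> (flow f \<sigma> t \<kappa>))) k) =
     integral {0..} (\<lambda>t. h t * (deriv u (\<sigma> (flow f \<sigma> t k)) * deriv \<sigma> (flow f \<sigma> t k) *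
       linearized_flow f \<sigma> k 1 t))"
    by (rule integral_cong) (simp add: DERIV_imp_deriv[OF utility_flow_has_real_derivative])
  ultimately show ?thesis by simp
qed

lemma value_function_integral:
  "((\<lambda>t. h t * u (\<sigma> (flow f \<sigma> t k))) has_integral value_function u h f \<sigma> k) {0..}"
  using reg by (auto simp: regular_strategy_def value_function_def intro: integrable_integral)

text \<open>Linearity of the linearized flow lets the factor \<open>\<sigma> k - c\<close> leave the
  integral; what remains is the derivative of the value function.\<close>

lemma P1_eq:
  "P1 u h f k \<sigma> c = u c - u (\<sigma> k) + (\<sigma> k - c) * deriv (value_function u h f \<sigma>) k"
proof -
  have "integral {0..} (\<lambda>t. h t * deriv u (\<sigma> (flow f \<sigma> t k)) * deriv \<sigma> (flow f \<sigma> t k) *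
          linearized_flow f \<sigma> k (\<sigma> k - c) t) =
      integral {0..} (\<lambda>t. (\<sigma> k - c) * (h t * (deriv u (\<sigma> (flow f \<sigma> t k)) *
          deriv \<sigma> (flow f \<sigma> t k) * linearized_flow f \<sigma> k 1 t)))"
    by (rule integral_cong) (simp add: linearized_flow_eq)
  then show ?thesis
    unfolding P1_def DERIV_imp_deriv[OF value_function_has_real_derivative] by simp
qed

text \<open>Necessity is Fermat's rule, as \<open>\<sigma> k\<close> is interior to the open set
  \<open>C\<close>. For sufficiency, the strict tangent inequality makes every other
  \<open>c\<close> strictly worse, so the maximizer is unique.\<close>

lemma arg_max_P1_iff:
  "{c. is_arg_max (P1 u h f k \<sigma>) (\<lambda>c. c \<in> C) c} = {\<sigma> k} \<longleftrightarrow>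
    deriv u (\<sigma> k) = deriv (value_function u h f \<sigma>) k"
proof
  let ?v' = "deriv (value_function u h f \<sigma>) k"
  assume "{c. is_arg_max (P1 u h f k \<sigma>) (\<lambda>c. c \<in> C) c} = {\<sigma> k}"
  then have max: "P1 u h f k \<sigma> c \<le> P1 u h f k \<sigma> (\<sigma> k)" if "c \<in> C" for c
    using that by (auto simp: is_arg_max_linorder set_eq_iff)
  obtain d where d: "d > 0" "ball (\<sigma> k) d \<subseteq> C"
    using C_open sigma_in_C[of k] by (meson openE)
  have "(P1 u h f k \<sigma> has_real_derivative deriv u (\<sigma> k) - ?v') (at (\<sigma> k))"
    unfolding P1_eq[abs_def]
    by (auto intro!: derivative_eq_intros u_has_real_derivative sigma_in_C)
  then have "deriv u (\<sigma> k) - ?v' = 0"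
    by (rule DERIV_local_max[OF _ d(1)]) (use d(2) max in \<open>auto simp: dist_real_def subset_iff\<close>)
  then show "deriv u (\<sigma> k) = ?v'" by simp
next
  assume foc: "deriv u (\<sigma> k) = deriv (value_function u h f \<sigma>) k"
  have "P1 u h f k \<sigma> c < P1 u h f k \<sigma> (\<sigma> k)" if "c \<in> C" "c \<noteq> \<sigma> k" for c
    using u_below_tangent[OF sigma_in_C that(1)] that(2)
    by (simp add: P1_eq foc[symmetric] algebra_simps)
  then show "{c. is_arg_max (P1 u h f k \<sigma>) (\<lambda>c. c \<in> C) c} = {\<sigma> k}"
    using sigma_in_C[of k] by (force simp: is_arg_max_def)
qed

end

section \<open>Equilibrium as a first-order condition, and the two implications\<close>

lemma equilibrium_strategy_iff:
  assumes "convergent_strategy C f \<sigma>" "regular_strategy u h f \<sigma>"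
  shows "equilibrium_strategy C u h f \<sigma> \<longleftrightarrow>
    (\<forall>k. deriv u (\<sigma> k) = deriv (value_function u h f \<sigma>) k)"
  using assms arg_max_P1_iff[of \<sigma>]
  by (auto simp: equilibrium_strategy_def convergent_strategy_def)

end

theorem theorem2:
  fixes C :: "real set" and u h f :: "real \<Rightarrow> real"
  assumes "growth_model C u h f"
  shows "(\<forall>\<sigma> v :: real \<Rightarrow> real.
            convergent_strategy C f \<sigma> \<longrightarrow>
            regular_strategy u h f \<sigma> \<longrightarrow>
            equilibrium_strategy C u h f \<sigma> \<longrightarrow>
            v = value_function u h f \<sigma> \<longrightarrow>
              integrated_equation C u h f v \<and>
              (\<forall>k. v differentiable at k \<and>
                   deriv u (\<sigma> k) = deriv v k \<and>
                   \<sigma> k = inv_marginal C u (deriv v k))) \<and>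
         (\<forall>v :: real \<Rightarrow> real.
            v C1_differentiable_on UNIV \<longrightarrow>
            deriv v C1_differentiable_on UNIV \<longrightarrow>
            range (deriv v) \<subseteq> deriv u ` C \<longrightarrow>
            convergent_strategy C f (inv_marginal C u \<circ> deriv v) \<longrightarrow>
            regular_strategy u h f (inv_marginal C u \<circ> deriv v) \<longrightarrow>
            integrated_equation C u h f v \<longrightarrow>
              equilibrium_strategy C u h f (inv_marginal C u \<circ> deriv v))"
proof -
  interpret growth_model C u h f by (rule assms)
  show ?thesis
  proof (rule conjI; intro allI impI)
    fix \<sigma> v :: "real \<Rightarrow> real"
    assume conv: "convergent_strategy C f \<sigma>" and reg: "regular_strategy u h f \<sigma>"
      and eq: "equilibrium_strategy C u h f \<sigma>" and v: "v = value_function u h f \<sigma>"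
    have strat: "strategy C \<sigma>"
      using conv by (simp add: convergent_strategy_def)
    have foc: "deriv u (\<sigma> k) = deriv v k" for k
      using eq equilibrium_strategy_iff[OF conv reg] v by simp
    have inv: "\<sigma> k = inv_marginal C u (deriv v k)" for k
      using inv_into_f_f[OF inj_on_deriv_u sigma_in_C[OF strat reg, of k]]
      by (simp add: inv_marginal_def foc)
    \<comment> \<open>After this identification (IE) is the integral defining the value function,
      whose convergence comes from regularity.\<close>
    then have "inv_marginal C u \<circ> deriv v = \<sigma>" by auto
    then have "integrated_equation C u h f v"
      using value_function_integral[OF strat reg] by (simp add: integrated_equation_def v)
    moreover have "v differentiable at k" for k
      using value_function_has_real_derivative[OF strat reg, of k]
      by (auto simp: v real_differentiable_def)
    ultimately show "integrated_equation C u h f v \<and>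
        (\<forall>k. v differentiable at k \<and> deriv u (\<sigma> k) = deriv v k \<and>
             \<sigma> k = inv_marginal C u (deriv v k))"
      using foc inv by blast
  next
    fix v :: "real \<Rightarrow> real"
    let ?\<sigma> = "inv_marginal C u \<circ> deriv v"
    assume range: "range (deriv v) \<subseteq> deriv u ` C" and conv: "convergent_strategy C f ?\<sigma>"
      and reg: "regular_strategy u h f ?\<sigma>" and IE: "integrated_equation C u h f v"
    \<comment> \<open>The right-hand side of (IE) is the value function of \<open>?\<sigma>\<close>,
      so (IE) determines \<open>v\<close>.\<close>
    have "v = value_function u h f ?\<sigma>"
      using integral_unique[OF IE[unfolded integrated_equation_def, rule_format]]
      by (simp add: fun_eq_iff value_function_def)
    \<comment> \<open>The inverse is a right inverse only on the image of \<open>deriv u\<close>,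
      hence the appeal to the range of \<open>deriv v\<close>.\<close>
    moreover have "deriv u (?\<sigma> k) = deriv v k" for k
      using range by (auto simp: inv_marginal_def intro!: f_inv_into_f)
    ultimately show "equilibrium_strategy C u h f ?\<sigma>"
      using equilibrium_strategy_iff[OF conv reg] by simp
  qed
qed

end
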